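(* Let $G$ be a connected, locally finite metric graph and let $k,m\ge 0$. If $G$ is $(k,m)$-edge-chordal, then there exists $\varepsilon>0$ such that $G$ is $\varepsilon$-densely $(k,m)$-path-chordal.
   Context: A metric graph is a graph $G$ in which every edge $e$ is regarded as isometric to an interval $[0,l_e]$ (no restriction on the lengths $l_e>0$); interior points of edges are points of $G$, and $d(x,y)$ is the length of a shortest path in $G$ joining $x$ and $y$. A cycle is a simple closed curve in $G$ (a closed path through vertices that are all distinct except the first and the last). For a cycle $C$, $d_C$ denotes the length metric on $C$ and $L(\cdot)$ denotes length. A shortcut in a cycle $C$ is a path $\sigma$ in $G$ joining two vertices $p,q$ of $C$ with $L(\sigma)<d_C(p,q)$; it is strict if $\sigma\cap C=\{p,q\}$, and then $p,q$ are called shortcut vertices associated to $\sigma$. An edge-shortcut is an edge of $G$ which is a shortcut of $C$. $G$ is $(k,m)$-edge-chordal if every cycle $C$ with $L(C)\ge k$ has an edge-shortcut $e$ with $L(e)\le m$. A subset $A$ of a metric space $X$ is $\varepsilon$-dense if for every $x\in X$ there is $a\in A$ with $d(a,x)<\varepsilon$. $G$ is $\varepsilon$-densely $(k,m)$-path-chordal if for every cycle $C$ with $L(C)\ge k$ there exist strict shortcuts $\sigma_1,\dots,\sigma_r$ of $C$ with $L(\sigma_i)\le m$ such that their associated shortcut vertices form an $\varepsilon$-dense subset of $(C,d_C)$. *)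

theory Defs
  imports Complex_Main
begin

text \<open>
  Graphs may have loops and multiple edges. The orientation given by \<open>src\<close> and \<open>tgt\<close>
  serves only to parametrise an edge \<open>e\<close> by the interval from \<open>0\<close> to \<open>len e\<close>.
\<close>

record ('v, 'e) mgraph =
  verts :: "'v set"
  edges :: "'e set"
  src :: "'e \<Rightarrow> 'v"
  tgt :: "'e \<Rightarrow> 'v"
  len :: "'e \<Rightarrow> real"

definition metric_graph :: "('v, 'e) mgraph \<Rightarrow> bool" where
  "metric_graph G \<longleftrightarrow>
     (\<forall>e \<in> edges G. src G e \<in> verts G \<and> tgt G e \<in> verts G \<and> 0 < len G e)"

definition locally_finite :: "('v, 'e) mgraph \<Rightarrow> bool" where
  "locally_finite G \<longleftrightarrow>
     (\<forall>v \<in> verts G. finite {e \<in> edges G. src G e = v \<or> tgt G e = v})"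

datatype ('v, 'e) point = Vertex 'v | Inner 'e real

text \<open>The point at distance \<open>t\<close> from the source along the edge \<open>e\<close>.\<close>

definition edge_point :: "('v, 'e) mgraph \<Rightarrow> 'e \<Rightarrow> real \<Rightarrow> ('v, 'e) point" where
  "edge_point G e t =
     (if t = 0 then Vertex (src G e)
      else if t = len G e then Vertex (tgt G e)
      else Inner e t)"

definition points :: "('v, 'e) mgraph \<Rightarrow> ('v, 'e) point set" where
  "points G = Vertex ` verts G \<union> (\<Union>e \<in> edges G. edge_point G e ` {0..len G e})"

text \<open>
  A path is a list of segments \<open>(e, s, t)\<close>, each running along the edge \<open>e\<close> from
  parameter \<open>s\<close> to parameter \<open>t\<close>. Its end points may be interior points of edges.
\<close>

type_synonym 'e path = "('e \<times> real \<times> real) list"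

fun path_between ::
  "('v, 'e) mgraph \<Rightarrow> ('v, 'e) point \<Rightarrow> 'e path \<Rightarrow> ('v, 'e) point \<Rightarrow> bool" where
  "path_between G x [] y \<longleftrightarrow> x \<in> points G \<and> x = y"
| "path_between G x ((e, s, t) # \<sigma>) y \<longleftrightarrow>
     e \<in> edges G \<and> s \<in> {0..len G e} \<and> t \<in> {0..len G e} \<and>
     x = edge_point G e s \<and> path_between G (edge_point G e t) \<sigma> y"

definition path_length :: "'e path \<Rightarrow> real" where
  "path_length \<sigma> = (\<Sum>(e, s, t) \<leftarrow> \<sigma>. \<bar>t - s\<bar>)"

definition path_image :: "('v, 'e) mgraph \<Rightarrow> 'e path \<Rightarrow> ('v, 'e) point set" where
  "path_image G \<sigma> = (\<Union>(e, s, t) \<in> set \<sigma>. edge_point G e ` {min s t..max s t})"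

definition connected_graph :: "('v, 'e) mgraph \<Rightarrow> bool" where
  "connected_graph G \<longleftrightarrow> (\<forall>x \<in> points G. \<forall>y \<in> points G. \<exists>\<sigma>. path_between G x \<sigma> y)"

definition gdist :: "('v, 'e) mgraph \<Rightarrow> ('v, 'e) point \<Rightarrow> ('v, 'e) point \<Rightarrow> real" where
  "gdist G x y = Inf {path_length \<sigma> | \<sigma>. path_between G x \<sigma> y}"

definition joins :: "('v, 'e) mgraph \<Rightarrow> 'e \<Rightarrow> 'v \<Rightarrow> 'v \<Rightarrow> bool" where
  "joins G e u v \<longleftrightarrow> src G e = u \<and> tgt G e = v \<or> src G e = v \<and> tgt G e = u"

text \<open>
  A cycle is a subgraph \<open>C\<close> of \<open>G\<close>, hence itself a metric graph; its length metric is
  \<open>gdist C\<close>. Distinctness of the edges only matters for two vertices, where it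
  excludes traversing one edge back and forth.
\<close>

definition cycle :: "('v, 'e) mgraph \<Rightarrow> ('v, 'e) mgraph \<Rightarrow> bool" where
  "cycle G C \<longleftrightarrow>
     (\<exists>vs es. es \<noteq> [] \<and> length vs = length es \<and> distinct vs \<and> distinct es \<and>
        set vs \<subseteq> verts G \<and> set es \<subseteq> edges G \<and>
        (\<forall>i < length es. joins G (es ! i) (vs ! i) (vs ! (Suc i mod length es))) \<and>
        C = G\<lparr>verts := set vs, edges := set es\<rparr>)"

definition total_length :: "('v, 'e) mgraph \<Rightarrow> real" where
  "total_length C = (\<Sum>e \<in> edges C. len C e)"

definition shortcut ::
  "('v, 'e) mgraph \<Rightarrow> ('v, 'e) mgraph \<Rightarrow> 'e path \<Rightarrow> 'v \<Rightarrow> 'v \<Rightarrow> bool" where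
  "shortcut G C \<sigma> p q \<longleftrightarrow>
     p \<in> verts C \<and> q \<in> verts C \<and> path_between G (Vertex p) \<sigma> (Vertex q) \<and>
     path_length \<sigma> < gdist C (Vertex p) (Vertex q)"

definition strict_shortcut ::
  "('v, 'e) mgraph \<Rightarrow> ('v, 'e) mgraph \<Rightarrow> 'e path \<Rightarrow> 'v \<Rightarrow> 'v \<Rightarrow> bool" where
  "strict_shortcut G C \<sigma> p q \<longleftrightarrow>
     shortcut G C \<sigma> p q \<and> path_image G \<sigma> \<inter> points C = {Vertex p, Vertex q}"

definition edge_shortcut :: "('v, 'e) mgraph \<Rightarrow> ('v, 'e) mgraph \<Rightarrow> 'e \<Rightarrow> bool" where
  "edge_shortcut G C e \<longleftrightarrow> e \<in> edges G \<and> (\<exists>p q. shortcut G C [(e, 0, len G e)] p q)"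

definition edge_chordal :: "('v, 'e) mgraph \<Rightarrow> real \<Rightarrow> real \<Rightarrow> bool" where
  "edge_chordal G k m \<longleftrightarrow>
     (\<forall>C. cycle G C \<and> total_length C \<ge> k \<longrightarrow> (\<exists>e. edge_shortcut G C e \<and> len G e \<le> m))"

definition eps_dense :: "real \<Rightarrow> 'a set \<Rightarrow> 'a set \<Rightarrow> ('a \<Rightarrow> 'a \<Rightarrow> real) \<Rightarrow> bool" where
  "eps_dense \<epsilon> A X d \<longleftrightarrow> A \<subseteq> X \<and> (\<forall>x \<in> X. \<exists>a \<in> A. d a x < \<epsilon>)"

definition densely_path_chordal :: "real \<Rightarrow> ('v, 'e) mgraph \<Rightarrow> real \<Rightarrow> real \<Rightarrow> bool" where
  "densely_path_chordal \<epsilon> G k m \<longleftrightarrow>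
     (\<forall>C. cycle G C \<and> total_length C \<ge> k \<longrightarrow>
        (\<exists>S. finite S \<and>
           (\<forall>(\<sigma>, p, q) \<in> S. strict_shortcut G C \<sigma> p q \<and> path_length \<sigma> \<le> m) \<and>
           eps_dense \<epsilon> (\<Union>(\<sigma>, p, q) \<in> S. {Vertex p, Vertex q}) (points C) (gdist C)))"

end

theory Submission
  imports Defs
begin

text \<open>
  An edge-shortcut of a cycle \<open>C\<close> is automatically strict, so only the density of the shortcut
  vertices is at stake. Given a point \<open>x\<close> of \<open>C\<close>, cut \<open>C\<close> along an edge-shortcut and keep the
  cycle formed by the arc containing \<open>x\<close> and the shortcut; repeat this as long as the current
  cycle has length at least \<open>k\<close>. Every step shortens the cycle and does not increase distances
  between its vertices, so all edge-shortcuts that occur are edge-shortcuts of the original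
  \<open>C\<close>. Local finiteness forces termination at a cycle through \<open>x\<close> of length less than \<open>k\<close>;
  following it from \<open>x\<close> along edges of \<open>C\<close> one meets a shortcut vertex.
\<close>

section \<open>Paths and distances\<close>

lemma edge_point_0 [simp]: "edge_point H e 0 = Vertex (src H e)"
  by (simp add: edge_point_def)

lemma edge_point_len:
  "metric_graph H \<Longrightarrow> e \<in> edges H \<Longrightarrow> edge_point H e (len H e) = Vertex (tgt H e)"
  by (auto simp: edge_point_def metric_graph_def)

lemma edge_point_in_points:
  "e \<in> edges H \<Longrightarrow> t \<in> {0..len H e} \<Longrightarrow> edge_point H e t \<in> points H"
  unfolding points_def by blast

lemma Vertex_in_points: "v \<in> verts H \<Longrightarrow> Vertex v \<in> points H"
  by (auto simp: points_def)

lemma path_length_Nil [simp]: "path_length [] = 0"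
  by (simp add: path_length_def)

lemma path_length_Cons [simp]: "path_length ((e, s, t) # \<sigma>) = \<bar>t - s\<bar> + path_length \<sigma>"
  by (simp add: path_length_def)

lemma path_length_append [simp]:
  "path_length (\<sigma> @ \<tau>) = path_length \<sigma> + path_length \<tau>"
  by (simp add: path_length_def)

lemma path_length_nonneg: "0 \<le> path_length \<sigma>"
  by (auto simp: path_length_def intro!: sum_list_nonneg)

lemma path_between_append:
  "path_between H x \<sigma> y \<Longrightarrow> path_between H y \<tau> z \<Longrightarrow> path_between H x (\<sigma> @ \<tau>) z"
  by (induction H x \<sigma> y rule: path_between.induct) auto

lemma path_between_reverse:
  "path_between H x \<sigma> y \<Longrightarrow> \<exists>\<tau>. path_between H y \<tau> x \<and> path_length \<tau> = path_length \<sigma>"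
proof (induction H x \<sigma> y rule: path_between.induct)
  case (1 H x y)
  then show ?case by (intro exI[of _ "[]"]) auto
next
  case (2 H x e s t \<sigma> y)
  then obtain \<tau> where \<tau>: "path_between H y \<tau> (edge_point H e t)" "path_length \<tau> = path_length \<sigma>"
    by auto
  have "path_between H (edge_point H e t) [(e, t, s)] x"
    using 2 by (auto intro: edge_point_in_points)
  then show ?case
    using path_between_append[OF \<tau>(1)] \<tau>(2) by (intro exI[of _ "\<tau> @ [(e, t, s)]"]) auto
qed

section \<open>Elementary properties of the distance \<open>gdist\<close>\<close>

lemma gdist_le: "path_between H x \<sigma> y \<Longrightarrow> gdist H x y \<le> path_length \<sigma>"
  unfolding gdist_def
  by (rule cInf_lower) (auto intro!: bdd_belowI[of _ 0] simp: path_length_nonneg)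

text \<open>The path \<open>\<sigma>\<^sub>0\<close> makes the set of lengths nonempty;
  \<open>Inf {}\<close> on the reals has no useful value.\<close>

lemma gdist_ge:
  assumes "path_between H x \<sigma>\<^sub>0 y" "\<And>\<sigma>. path_between H x \<sigma> y \<Longrightarrow> c \<le> path_length \<sigma>"
  shows "c \<le> gdist H x y"
  unfolding gdist_def by (rule cInf_greatest) (use assms in auto)

lemma gdist_refl: "x \<in> points H \<Longrightarrow> gdist H x x = 0"
  by (rule antisym) (use gdist_le[of H x "[]" x] gdist_ge[of H x "[]" x 0] in
      \<open>auto simp: path_length_nonneg\<close>)

lemma gdist_commute_le:
  assumes "path_between H y \<sigma>\<^sub>0 x"
  shows "gdist H x y \<le> gdist H y x"
proof (rule gdist_ge[OF assms])
  fix \<sigma> assume "path_between H y \<sigma> x"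
  then show "gdist H x y \<le> path_length \<sigma>"
    using path_between_reverse gdist_le by metis
qed

lemma gdist_commute:
  "connected_graph H \<Longrightarrow> x \<in> points H \<Longrightarrow> y \<in> points H \<Longrightarrow> gdist H x y = gdist H y x"
  unfolding connected_graph_def by (meson gdist_commute_le antisym)

text \<open>Paths are concatenated; the two infima are taken one after the other, first over
  \<open>\<tau>\<close> for fixed \<open>\<sigma>\<close>, then over
  \<open>\<sigma>\<close>.\<close>

lemma gdist_triangle:
  assumes "connected_graph H" "x \<in> points H" "y \<in> points H" "z \<in> points H"
  shows "gdist H x z \<le> gdist H x y + gdist H y z"
proof -
  obtain \<sigma>\<^sub>0 \<tau>\<^sub>0 where p: "path_between H x \<sigma>\<^sub>0 y" "path_between H y \<tau>\<^sub>0 z"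
    using assms unfolding connected_graph_def by blast
  have "gdist H x z - path_length \<sigma> \<le> gdist H y z"
    if "path_between H x \<sigma> y" for \<sigma>
  proof (rule gdist_ge[OF p(2)])
    fix \<tau> assume "path_between H y \<tau> z"
    from gdist_le[OF path_between_append[OF that this]]
    show "gdist H x z - path_length \<sigma> \<le> path_length \<tau>" by simp
  qed
  then have "gdist H x z - gdist H y z \<le> gdist H x y"
    by (intro gdist_ge[OF p(1)]) (auto simp: algebra_simps)
  then show ?thesis by simp
qed

lemma gdist_same_edge:
  assumes "e \<in> edges H" "s \<in> {0..len H e}" "t \<in> {0..len H e}"
  shows "gdist H (edge_point H e s) (edge_point H e t) \<le> \<bar>t - s\<bar>"
  using gdist_le[of H "edge_point H e s" "[(e, s, t)]" "edge_point H e t"] assms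
    edge_point_in_points[of e H t] by auto

lemma metric_graphD:
  assumes "metric_graph H" "e \<in> edges H"
  shows "src H e \<in> verts H" "tgt H e \<in> verts H" "0 < len H e"
  using assms by (auto simp: metric_graph_def)

lemma gdist_edge:
  assumes "metric_graph H" "e \<in> edges H"
  shows "gdist H (Vertex (src H e)) (Vertex (tgt H e)) \<le> len H e"
  using gdist_same_edge[of e H 0 "len H e"] edge_point_len[OF assms] metric_graphD[OF assms] assms
  by auto

text \<open>
  A function on the vertices that is 1-Lipschitz across every edge bounds all distances from
  below, because it extends affinely along the edges.
\<close>

lemma potential_le_gdist:
  assumes H: "metric_graph H" "connected_graph H"
    and f: "\<And>e. e \<in> edges H \<Longrightarrow> \<bar>f (tgt H e) - f (src H e)\<bar> \<le> len H e"
    and uv: "u \<in> verts H" "v \<in> verts H"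
  shows "f v - f u \<le> gdist H (Vertex u) (Vertex v)"
proof -
  define h where "h z = (case z of Vertex v \<Rightarrow> f v
    | Inner e s \<Rightarrow> f (src H e) + (f (tgt H e) - f (src H e)) * s / len H e)" for z
  \<comment> \<open>The affine formula gives the values of \<open>f\<close> at both ends of an edge,
    so the two cases of \<open>h\<close> fit together.\<close>
  have h: "h (edge_point H e s) = f (src H e) + (f (tgt H e) - f (src H e)) * s / len H e"
    if "e \<in> edges H" for e s
    using metric_graphD(3)[OF H(1) that] by (auto simp: h_def edge_point_def)
  have step: "h (edge_point H e t) - h (edge_point H e s) \<le> \<bar>t - s\<bar>"
    if e: "e \<in> edges H" for e s t
  proof -
    have l: "0 < len H e" using metric_graphD(3)[OF H(1) e] .
    have "h (edge_point H e t) - h (edge_point H e s)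
        = (f (tgt H e) - f (src H e)) * (t - s) / len H e"
      using l by (simp add: h[OF e] field_simps)
    also have "\<dots> \<le> \<bar>f (tgt H e) - f (src H e)\<bar> * \<bar>t - s\<bar> / len H e"
      using l by (intro divide_right_mono) (auto simp flip: abs_mult)
    also have "\<dots> \<le> len H e * \<bar>t - s\<bar> / len H e"
      using l f[OF e] by (intro divide_right_mono mult_right_mono) auto
    finally show ?thesis using l by simp
  qed
  \<comment> \<open>The increments of \<open>h\<close> over the segments of a path
    telescope.\<close>
  have *: "path_between H x \<sigma> y \<Longrightarrow> h y - h x \<le> path_length \<sigma>" for x \<sigma> y
  proof (induction \<sigma> arbitrary: x)
    case Nil
    then show ?case by simp
  next
    case (Cons a \<sigma>)
    obtain e s t where a: "a = (e, s, t)" by (cases a)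
    from Cons.prems have e: "e \<in> edges H" and x: "x = edge_point H e s"
      and p: "path_between H (edge_point H e t) \<sigma> y" by (auto simp: a)
    from Cons.IH[OF p] step[OF e, of t s] show ?case by (simp add: a x)
  qed
  obtain \<sigma>\<^sub>0 where "path_between H (Vertex u) \<sigma>\<^sub>0 (Vertex v)"
    using H(2) uv Vertex_in_points unfolding connected_graph_def by meson
  from gdist_ge[OF this, of "f v - f u"] show ?thesis
    using *[of "Vertex u" _ "Vertex v"] by (auto simp: h_def)
qed

section \<open>Cyclic sequences of vertices and edges\<close>

text \<open>The body of \<open>cycle\<close> with its witnesses exposed: the subgraph alone forgets
  the cyclic order, on which rotating and cutting depend.\<close>

definition cycle_seq :: "('v, 'e) mgraph \<Rightarrow> 'v list \<Rightarrow> 'e list \<Rightarrow> bool" where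
  "cycle_seq G vs es \<longleftrightarrow> es \<noteq> [] \<and> length vs = length es \<and> distinct vs \<and> distinct es \<and>
     set vs \<subseteq> verts G \<and> set es \<subseteq> edges G \<and>
     (\<forall>i < length es. joins G (es ! i) (vs ! i) (vs ! (Suc i mod length es)))"

abbreviation subgraph_of :: "('v, 'e) mgraph \<Rightarrow> 'v set \<Rightarrow> 'e set \<Rightarrow> ('v, 'e) mgraph" where
  "subgraph_of G V E \<equiv> G\<lparr>verts := V, edges := E\<rparr>"

lemma edge_point_subgraph [simp]: "edge_point (subgraph_of G V E) = edge_point G"
  by (simp add: edge_point_def fun_eq_iff)

lemma joins_subgraph [simp]: "joins (subgraph_of G V E) = joins G"
  by (simp add: joins_def fun_eq_iff)

lemma cycle_iff_cycle_seq:
  "cycle G C \<longleftrightarrow> (\<exists>vs es. cycle_seq G vs es \<and> C = subgraph_of G (set vs) (set es))"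
  by (auto simp: cycle_def cycle_seq_def)

lemma cycle_seq_rotate:
  assumes "cycle_seq G vs es"
  shows "cycle_seq G (rotate n vs) (rotate n es)"
proof -
  let ?N = "length es"
  have N: "?N > 0" "length vs = ?N" using assms by (auto simp: cycle_seq_def)
  have "joins G (rotate n es ! i) (rotate n vs ! i) (rotate n vs ! (Suc i mod ?N))"
    if "i < ?N" for i
  proof -
    have "joins G (es ! ((n + i) mod ?N)) (vs ! ((n + i) mod ?N)) (vs ! (Suc ((n + i) mod ?N) mod ?N))"
      using assms N by (simp add: cycle_seq_def)
    moreover have "rotate n es ! i = es ! ((n + i) mod ?N)" "rotate n vs ! i = vs ! ((n + i) mod ?N)"
      "rotate n vs ! (Suc i mod ?N) = vs ! (Suc ((n + i) mod ?N) mod ?N)"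
      using that N by (simp_all add: nth_rotate mod_simps)
    ultimately show ?thesis by simp
  qed
  then show ?thesis using assms by (simp add: cycle_seq_def)
qed

text \<open>Brings any chosen vertex or edge to index 0; the vertex and edge sets, hence the
  subgraph, stay the same.\<close>

lemma cycle_seq_rotate_to:
  assumes "cycle_seq G vs es" "i < length es"
  obtains vs' es' where "cycle_seq G vs' es'" "set vs' = set vs" "set es' = set es"
    "vs' ! 0 = vs ! i" "es' ! 0 = es ! i"
proof
  show "cycle_seq G (rotate i vs) (rotate i es)" using assms cycle_seq_rotate by blast
  have "0 < length es" "length vs = length es" using assms by (auto simp: cycle_seq_def)
  then show "rotate i vs ! 0 = vs ! i" "rotate i es ! 0 = es ! i"
    using assms(2) by (simp_all add: nth_rotate)
qed simp_all

lemma cycle_seq_ends: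
  assumes "cycle_seq G vs es" "e \<in> set es"
  shows "src G e \<in> set vs" "tgt G e \<in> set vs"
proof -
  obtain i where i: "i < length es" "e = es ! i" using assms(2) by (auto simp: in_set_conv_nth)
  then have "joins G e (vs ! i) (vs ! (Suc i mod length es))" "i < length vs"
    "Suc i mod length es < length vs"
    using assms by (auto simp: cycle_seq_def)
  then show "src G e \<in> set vs" "tgt G e \<in> set vs" by (auto simp: joins_def)
qed

lemma metric_graph_cycle_seq:
  "metric_graph G \<Longrightarrow> cycle_seq G vs es \<Longrightarrow> metric_graph (subgraph_of G (set vs) (set es))"
  using cycle_seq_ends[of G vs es] by (auto simp: metric_graph_def cycle_seq_def)

section \<open>Walks along a cycle and its connectedness\<close>

lemma edge_path:
  assumes "metric_graph H" "e \<in> edges H" "joins H e u v"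
  shows "\<exists>\<sigma>. path_between H (Vertex u) \<sigma> (Vertex v) \<and> path_length \<sigma> = len H e"
proof -
  have "path_between H (Vertex (src H e)) [(e, 0, len H e)] (Vertex (tgt H e))"
    using assms metric_graphD[OF assms(1,2)] by (auto simp: edge_point_len Vertex_in_points)
  moreover have "path_length [(e, 0, len H e)] = len H e"
    using metric_graphD[OF assms(1,2)] by simp
  ultimately show ?thesis
    using assms(3) path_between_reverse unfolding joins_def by metis
qed

text \<open>\<open>w\<close> and \<open>g\<close> are functions of the index rather than lists, so
  that a walk can wrap around a cycle by taking indices modulo its length.\<close>

lemma walk_path:
  assumes H: "metric_graph H" and "a \<le> b" "Vertex (w a) \<in> points H"
    and "\<And>i. a \<le> i \<Longrightarrow> i < b \<Longrightarrow> g i \<in> edges H \<and> joins H (g i) (w i) (w (Suc i))"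
  shows "\<exists>\<sigma>. path_between H (Vertex (w a)) \<sigma> (Vertex (w b)) \<and> path_length \<sigma> = (\<Sum>i=a..<b. len H (g i))"
  using assms(2,4)
proof (induction b rule: dec_induct)
  case base
  then show ?case using assms(3) by (intro exI[of _ "[]"]) auto
next
  case (step n)
  then obtain \<sigma> where \<sigma>: "path_between H (Vertex (w a)) \<sigma> (Vertex (w n))"
    "path_length \<sigma> = (\<Sum>i=a..<n. len H (g i))" by auto
  obtain \<tau> where \<tau>: "path_between H (Vertex (w n)) \<tau> (Vertex (w (Suc n)))" "path_length \<tau> = len H (g n)"
    using edge_path[OF H, of "g n" "w n" "w (Suc n)"] step by auto
  show ?case
    using path_between_append[OF \<sigma>(1) \<tau>(1)] \<sigma>(2) \<tau>(2) step(1)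
    by (intro exI[of _ "\<sigma> @ \<tau>"]) auto
qed

text \<open>Every point is reached from \<open>vs ! 0\<close>: a vertex by walking along the
  sequence, a point of an edge by one further segment from the source of that edge.\<close>

lemma connected_cycle_seq:
  assumes G: "metric_graph G" and cs: "cycle_seq G vs es"
  shows "connected_graph (subgraph_of G (set vs) (set es))"
proof -
  let ?H = "subgraph_of G (set vs) (set es)"
  have H: "metric_graph ?H" using metric_graph_cycle_seq[OF assms] .
  have N: "length es > 0" "length vs = length es" using cs by (auto simp: cycle_seq_def)
  have v: "\<exists>\<sigma>. path_between ?H (Vertex (vs ! 0)) \<sigma> (Vertex v)"
    if v: "v \<in> set vs" for v
  proof -
    obtain i where i: "i < length es" "v = vs ! i" using v N by (auto simp: in_set_conv_nth)
    have "\<exists>\<sigma>. path_between ?H (Vertex (vs ! 0)) \<sigma> (Vertex (vs ! i)) \<and>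
        path_length \<sigma> = (\<Sum>l=0..<i. len ?H (es ! l))"
    proof (rule walk_path[OF H])
      show "Vertex (vs ! 0) \<in> points ?H" using N by (intro Vertex_in_points) auto
      fix l assume "l < i"
      then have "l < length es" "Suc l mod length es = Suc l" using i by auto
      then show "es ! l \<in> edges ?H \<and> joins ?H (es ! l) (vs ! l) (vs ! Suc l)"
        using cs by (auto simp: cycle_seq_def)
    qed simp
    then show ?thesis using i by auto
  qed
  have p: "\<exists>\<sigma>. path_between ?H (Vertex (vs ! 0)) \<sigma> x"
    if x: "x \<in> points ?H" for x
  proof -
    consider v where "v \<in> set vs" "x = Vertex v"
      | e t where "e \<in> set es" "t \<in> {0..len G e}" "x = edge_point G e t"
      using x unfolding points_def by auto
    then show ?thesis
    proof cases
      case 1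
      then show ?thesis using v by blast
    next
      case 2
      have "path_between ?H (Vertex (src G e)) [(e, 0, t)] x"
        using 2 edge_point_in_points[of e ?H t] by auto
      then show ?thesis
        using v[OF cycle_seq_ends(1)[OF cs 2(1)]] path_between_append by blast
    qed
  qed
  show ?thesis
    unfolding connected_graph_def
    using p path_between_reverse path_between_append by meson
qed

text \<open>Each vertex of the cycle is an end of the edge at its index, so every point, vertex or
  not, has coordinates on some edge.\<close>

lemma points_cycle_seq:
  assumes G: "metric_graph G" and cs: "cycle_seq G vs es"
    and x: "x \<in> points (subgraph_of G (set vs) (set es))"
  obtains e t where "e \<in> set es" "t \<in> {0..len G e}" "x = edge_point G e t"
proof -
  have "\<exists>e\<in>set es. \<exists>t\<in>{0..len G e}. Vertex v = edge_point G e t"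
    if v: "v \<in> set vs" for v
  proof -
    obtain i where i: "i < length es" "v = vs ! i"
      using v cs by (auto simp: in_set_conv_nth cycle_seq_def)
    then have e: "es ! i \<in> set es" "es ! i \<in> edges G"
      and j: "src G (es ! i) = v \<or> tgt G (es ! i) = v"
      using cs by (auto simp: cycle_seq_def joins_def)
    then show ?thesis
      using edge_point_len[OF G e(2)] metric_graphD(3)[OF G e(2)]
      by (intro bexI[OF _ e(1)] bexI[of _ "if src G (es ! i) = v then 0 else len G (es ! i)"]) auto
  qed
  then show ?thesis using x that unfolding points_def by fastforce
qed

lemma total_length_cycle_seq:
  "cycle_seq G vs es \<Longrightarrow>
     total_length (subgraph_of G (set vs) (set es)) = (\<Sum>i<length es. len G (es ! i))"
  by (simp add: total_length_def cycle_seq_def sum.distinct_set_conv_list sum_list_sum_nth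
      atLeast0LessThan)

section \<open>Cutting a cycle along an edge-shortcut\<close>

text \<open>
  Here \<open>D'\<close> arises from \<open>D\<close> by replacing the part of \<open>D\<close> spanned by \<open>B\<close> by the edge \<open>e\<close>. The
  potential is the distance from \<open>u\<close> in \<open>D'\<close>, continued into \<open>B\<close> through the end points of \<open>e\<close>.
\<close>

lemma gdist_replace_by_edge:
  assumes D: "metric_graph D" "connected_graph D" and D': "metric_graph D'" "connected_graph D'"
    and same: "src D' = src D" "tgt D' = tgt D" "len D' = len D"
    and e: "e \<in> edges D'" "src D e = p" "tgt D e = q"
    and short: "len D e \<le> gdist D (Vertex p) (Vertex q)"
    and sub: "verts D' \<subseteq> verts D"
    and B: "B \<subseteq> verts D" "B \<inter> verts D' \<subseteq> {p, q}"
    and edges: "\<And>a. a \<in> edges D \<Longrightarrow> a \<in> edges D' \<or> src D a \<in> B \<and> tgt D a \<in> B"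
    and uv: "u \<in> verts D'" "v \<in> verts D'"
  shows "gdist D' (Vertex u) (Vertex v) \<le> gdist D (Vertex u) (Vertex v)"
proof -
  define g where "g w = gdist D' (Vertex u) (Vertex w)" for w
  define d where "d x y = gdist D (Vertex x) (Vertex y)" for x y
  define h where "h w = min (g p + d p w) (g q + d q w)" for w
  define f where "f w = (if w \<in> verts D' then g w else h w)" for w
  have pq: "p \<in> verts D'" "q \<in> verts D'" using metric_graphD[OF D'(1) e(1)] e same by auto
  then have pqD: "p \<in> verts D" "q \<in> verts D" using sub by auto
  have g: "\<bar>g (tgt D a) - g (src D a)\<bar> \<le> len D a" if a: "a \<in> edges D'" for a
  proof -
    have "src D a \<in> verts D'" "tgt D a \<in> verts D'"
      using metric_graphD[OF D'(1) a] same by auto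
    then have V: "Vertex u \<in> points D'" "Vertex (src D a) \<in> points D'" "Vertex (tgt D a) \<in> points D'"
      using uv by (auto intro: Vertex_in_points)
    show ?thesis
      using gdist_triangle[OF D'(2) V(1,2,3)] gdist_triangle[OF D'(2) V(1,3,2)]
        gdist_commute[OF D'(2) V(2,3)] gdist_edge[OF D'(1) a] same
      unfolding g_def by auto
  qed
  have dtri: "d x z \<le> d x y + d y z"
    if "x \<in> verts D" "y \<in> verts D" "z \<in> verts D" for x y z
    unfolding d_def using that by (intro gdist_triangle[OF D(2)] Vertex_in_points)
  have dcomm: "d x y = d y x" if "x \<in> verts D" "y \<in> verts D" for x y
    unfolding d_def using that by (intro gdist_commute[OF D(2)] Vertex_in_points)
  have drefl: "d x x = 0" if "x \<in> verts D" for x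
    unfolding d_def using that by (intro gdist_refl Vertex_in_points)
  \<comment> \<open>By \<open>short\<close>, a detour through the other end of \<open>e\<close>
    gains nothing. So \<open>h\<close> agrees with \<open>g\<close> at \<open>p\<close> and
    \<open>q\<close>, the only vertices that \<open>B\<close> and \<open>D'\<close> can share, and
    \<open>f\<close> equals \<open>h\<close> on all of \<open>B\<close>.\<close>
  have "\<bar>g q - g p\<bar> \<le> d p q" using g[OF e(1)] e short unfolding d_def by auto
  then have "h p = g p" "h q = g q"
    using drefl pqD dcomm[OF pqD] by (auto simp: h_def)
  then have fB: "f w = h w" if "w \<in> B" for w
    using that B by (auto simp: f_def)
  have "\<bar>f (tgt D a) - f (src D a)\<bar> \<le> len D a" if a: "a \<in> edges D" for a
    using edges[OF a]
  proof
    assume a': "a \<in> edges D'"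
    then have "src D a \<in> verts D'" "tgt D a \<in> verts D'"
      using metric_graphD[OF D'(1)] same by auto
    then show ?thesis using g[OF a'] by (simp add: f_def)
  next
    \<comment> \<open>On \<open>B\<close> the potential is a minimum of two functions, each a
      constant plus a distance in \<open>D\<close>, hence 1-Lipschitz across
      \<open>a\<close>.\<close>
    assume ab: "src D a \<in> B \<and> tgt D a \<in> B"
    have V: "src D a \<in> verts D" "tgt D a \<in> verts D" using metric_graphD[OF D(1) a] by auto
    have "d (src D a) (tgt D a) \<le> len D a" unfolding d_def using gdist_edge[OF D(1) a] .
    then show ?thesis
      using ab dtri[OF pqD(1) V] dtri[OF pqD(2) V] dtri[OF pqD(1) V(2,1)] dtri[OF pqD(2) V(2,1)]
        dcomm[OF V] by (auto simp: fB h_def)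
  qed
  from potential_le_gdist[OF D this, of u v] have "f v - f u \<le> gdist D (Vertex u) (Vertex v)"
    using uv sub by auto
  moreover have "f v = g v" "f u = 0"
    using uv by (auto simp: f_def g_def intro!: gdist_refl Vertex_in_points)
  ultimately show ?thesis by (simp add: g_def)
qed

text \<open>The kept arc runs from \<open>vs ! 0\<close> to \<open>vs ! j\<close> and is closed by
  \<open>e\<close>. The dropped arc joins the ends of \<open>e\<close> inside \<open>D\<close>, so
  it is longer than \<open>e\<close> and the cycle gets shorter. For the distances, the vertices of
  the dropped arc form the set \<open>B\<close> of \<open>gdist_replace_by_edge\<close>.\<close>

lemma cut_cycle_seq:
  assumes G: "metric_graph G" and cs: "cycle_seq G vs es"
    and D: "D = subgraph_of G (set vs) (set es)"
    and j: "0 < j" "j < length es"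
    and e: "e \<in> edges G" "joins G e (vs ! 0) (vs ! j)"
    and short: "len G e < gdist D (Vertex (src G e)) (Vertex (tgt G e))"
    and D': "D' = subgraph_of G (set (take (Suc j) vs)) (set (take j es @ [e]))"
  shows "cycle G D'" "total_length D' < total_length D"
    "\<And>u v. u \<in> verts D' \<Longrightarrow> v \<in> verts D' \<Longrightarrow>
       gdist D' (Vertex u) (Vertex v) \<le> gdist D (Vertex u) (Vertex v)"
proof -
  let ?n = "length es"
  let ?vs = "take (Suc j) vs" and ?es = "take j es @ [e]"
  have n: "length vs = ?n" and dv: "distinct vs" and de: "distinct es"
    using cs by (auto simp: cycle_seq_def)
  have mD: "metric_graph D" and cD: "connected_graph D"
    using metric_graph_cycle_seq[OF G cs] connected_cycle_seq[OF G cs] D by auto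
  have jo: "joins G (es ! i) (vs ! i) (vs ! (Suc i mod ?n))" if "i < ?n" for i
    using cs that by (auto simp: cycle_seq_def)
  \<comment> \<open>The ends of an edge of \<open>D\<close> are at distance at most its length in
    \<open>D\<close>, which \<open>short\<close> excludes for \<open>e\<close>.\<close>
  have ne: "e \<notin> set es"
    using short gdist_edge[OF mD, of e] D by auto
  have cs': "cycle_seq G ?vs ?es"
    unfolding cycle_seq_def
  proof (intro conjI allI impI)
    show "length ?vs = length ?es" "distinct ?vs" using j n dv by auto
    show "distinct ?es" using de ne by (auto dest: in_set_takeD)
    show "set ?vs \<subseteq> verts G" "set ?es \<subseteq> edges G"
      using cs e(1) by (auto simp: cycle_seq_def dest: in_set_takeD)
    fix i assume "i < length ?es"
    then consider "i < j" | "i = j" using j by fastforce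
    then show "joins G (?es ! i) (?vs ! i) (?vs ! (Suc i mod length ?es))"
    proof cases
      case 1
      then show ?thesis using jo[of i] j by (simp add: nth_append)
    next
      case 2
      then show ?thesis using e(2) j by (auto simp: nth_append joins_def)
    qed
  qed simp
  show "cycle G D'" using cs' D' cycle_iff_cycle_seq by blast
  have mD': "metric_graph D'" and cD': "connected_graph D'"
    using metric_graph_cycle_seq[OF G cs'] connected_cycle_seq[OF G cs'] D' by auto
  \<comment> \<open>Indices are reduced modulo \<open>?n\<close>, so that the walk closes up at
    \<open>vs ! 0\<close> when it reaches index \<open>?n\<close>.\<close>
  have "\<exists>\<sigma>. path_between D (Vertex (vs ! (j mod ?n))) \<sigma> (Vertex (vs ! (?n mod ?n))) \<and>
      path_length \<sigma> = (\<Sum>i=j..<?n. len D (es ! i))"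
  proof (rule walk_path[OF mD])
    show "Vertex (vs ! (j mod ?n)) \<in> points D" using j n D by (intro Vertex_in_points) auto
    show "es ! i \<in> edges D \<and> joins D (es ! i) (vs ! (i mod ?n)) (vs ! (Suc i mod ?n))"
      if "j \<le> i" "i < ?n" for i
      using jo[of i] that D by simp
  qed (use j in auto)
  then obtain \<sigma> where \<sigma>: "path_between D (Vertex (vs ! j)) \<sigma> (Vertex (vs ! 0))"
    "path_length \<sigma> = (\<Sum>i=j..<?n. len G (es ! i))"
    using j D by auto
  \<comment> \<open>The source of \<open>e\<close> may be \<open>vs ! 0\<close> or
    \<open>vs ! j\<close>, so the dropped arc is taken in both directions.\<close>
  obtain \<tau> where \<tau>: "path_between D (Vertex (vs ! 0)) \<tau> (Vertex (vs ! j))" "path_length \<tau> = path_length \<sigma>"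
    using path_between_reverse[OF \<sigma>(1)] by blast
  have "len G e < (\<Sum>i=j..<?n. len G (es ! i))"
    using short gdist_le[OF \<sigma>(1)] gdist_le[OF \<tau>(1)] \<sigma>(2) \<tau>(2) e(2) unfolding joins_def by auto
  moreover have "total_length D' = (\<Sum>i<j. len G (es ! i)) + len G e"
    using total_length_cycle_seq[OF cs'] j D' by (simp add: nth_append)
  moreover have "total_length D = (\<Sum>i<j. len G (es ! i)) + (\<Sum>i=j..<?n. len G (es ! i))"
    using total_length_cycle_seq[OF cs] j D
    by (simp add: lessThan_atLeast0 sum.atLeastLessThan_concat)
  ultimately show "total_length D' < total_length D" by simp
  fix u v assume uv: "u \<in> verts D'" "v \<in> verts D'"
  \<comment> \<open>The dropped arc ends at \<open>vs ! 0\<close>, which \<open>drop j vs\<close>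
    does not contain.\<close>
  define B where "B = insert (vs ! 0) (set (drop j vs))"
  \<comment> \<open>As \<open>vs\<close> is distinct, the two arcs share only \<open>vs ! j\<close>,
    apart from \<open>vs ! 0\<close>.\<close>
  have "v = vs ! j" if "v \<in> set (drop j vs)" "v \<in> set (take (Suc j) vs)" for v
  proof -
    obtain a where a: "a < length (drop j vs)" "v = drop j vs ! a"
      using \<open>v \<in> set (drop j vs)\<close> by (auto simp: in_set_conv_nth)
    obtain b where b: "b < length (take (Suc j) vs)" "v = take (Suc j) vs ! b"
      using \<open>v \<in> set (take (Suc j) vs)\<close> by (metis in_set_conv_nth)
    have "vs ! (j + a) = vs ! b" "j + a < length vs" "b < length vs" "b \<le> j" using a b by auto
    then have "j + a = b" using dv nth_eq_iff_index_eq by blast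
    then show ?thesis using b \<open>b \<le> j\<close> by auto
  qed
  then have B1: "B \<inter> verts D' \<subseteq> {src G e, tgt G e}"
    using e(2) by (auto simp: B_def D' joins_def)
  have vB: "vs ! i \<in> B" if "j \<le> i" "i < ?n" for i
  proof -
    have "drop j vs ! (i - j) \<in> set (drop j vs)" using that n by (intro nth_mem) auto
    then show ?thesis using that n by (simp add: B_def)
  qed
  have B2: "a \<in> edges D' \<or> src D a \<in> B \<and> tgt D a \<in> B"
    if a: "a \<in> edges D" for a
  proof -
    obtain i where i: "i < ?n" "a = es ! i" using a D by (auto simp: in_set_conv_nth)
    show ?thesis
    proof (cases "i < j")
      case True
      then have "take j es ! i \<in> set (take j es)" using i by (intro nth_mem) auto
      then show ?thesis using True i D' by auto
    next
      case False
      have "vs ! (Suc i mod ?n) \<in> B"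
      proof (cases "Suc i = ?n")
        case True
        then show ?thesis by (simp add: B_def)
      next
        case False
        then show ?thesis using vB[of "Suc i"] i \<open>\<not> i < j\<close> by simp
      qed
      then show ?thesis using jo[OF i(1)] vB[of i] i False D by (auto simp: joins_def)
    qed
  qed
  have "vs ! 0 \<in> set vs" using j n by (intro nth_mem) auto
  then have B3: "B \<subseteq> verts D" by (auto simp: B_def D dest: in_set_dropD)
  show "gdist D' (Vertex u) (Vertex v) \<le> gdist D (Vertex u) (Vertex v)"
    by (rule gdist_replace_by_edge[OF mD cD mD' cD', where e = e and B = B])
      (use short uv B1 B2 B3 in \<open>auto simp: D D' dest: in_set_takeD\<close>)
qed

text \<open>Rotating the cycle, the arc containing \<open>x\<close> may be assumed to come first.\<close>

lemma cut_cycle: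
  assumes G: "metric_graph G" and D: "cycle G D" and x: "x \<in> points D"
    and e: "e \<in> edges G" "src G e \<in> verts D" "tgt G e \<in> verts D"
    and short: "len G e < gdist D (Vertex (src G e)) (Vertex (tgt G e))"
  obtains D' where "cycle G D'" "total_length D' < total_length D" "x \<in> points D'"
    "verts D' \<subseteq> verts D" "e \<in> edges D'" "edges D' \<subseteq> insert e (edges D)"
    "\<And>u v. u \<in> verts D' \<Longrightarrow> v \<in> verts D' \<Longrightarrow>
       gdist D' (Vertex u) (Vertex v) \<le> gdist D (Vertex u) (Vertex v)"
proof -
  obtain vs0 es0 where cs0: "cycle_seq G vs0 es0" "D = subgraph_of G (set vs0) (set es0)"
    using D cycle_iff_cycle_seq by metis
  obtain i where i: "i < length es0" "vs0 ! i = src G e"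
    using e(2) cs0 by (auto simp: in_set_conv_nth cycle_seq_def)
  obtain vs es where cs: "cycle_seq G vs es" "set vs = set vs0" "set es = set es0"
    and v0: "vs ! 0 = src G e"
    using cycle_seq_rotate_to[OF cs0(1) i(1)] i(2) by metis
  have Deq: "D = subgraph_of G (set vs) (set es)" using cs cs0 by simp
  have n: "length vs = length es" using cs by (auto simp: cycle_seq_def)
  obtain j where j: "j < length es" "vs ! j = tgt G e"
    using e(3) Deq n by (auto simp: in_set_conv_nth)
  \<comment> \<open>A loop joins a vertex to itself, at distance 0, so it violates
    \<open>short\<close>.\<close>
  have "j \<noteq> 0"
  proof
    assume "j = 0"
    then have "src G e = tgt G e" using j v0 by simp
    then show False
      using short gdist_refl[OF Vertex_in_points[OF e(2)]] metric_graphD(3)[OF G e(1)] by simp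
  qed
  then have j0: "0 < j" by simp
  obtain a t where a: "a \<in> set es" "t \<in> {0..len G a}" "x = edge_point G a t"
    using points_cycle_seq[OF G cs(1), of x] x Deq by auto
  note result = that
  \<comment> \<open>The cut itself is done once, for any cyclic sequence in which the edge
    \<open>a\<close> carrying \<open>x\<close> comes before the second end of \<open>e\<close>; the
    cases below supply the sequence.\<close>
  have *: thesis
    if cs': "cycle_seq G us fs" "set us = set vs" "set fs = set es"
      and l: "0 < l" "l < length fs" "joins G e (us ! 0) (us ! l)" "a \<in> set (take l fs)" for us fs l
  proof -
    define D' where "D' = subgraph_of G (set (take (Suc l) us)) (set (take l fs @ [e]))"
    have "D = subgraph_of G (set us) (set fs)" using cs' Deq by simp
    note cut = cut_cycle_seq[OF G cs'(1) this l(1,2) e(1) l(3) short D'_def]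
    have "x \<in> points D'"
      using edge_point_in_points[of a D' t] a l(4) by (simp add: D'_def)
    moreover have "verts D' \<subseteq> verts D" "edges D' \<subseteq> insert e (edges D)"
      using cs' Deq by (auto simp: D'_def dest: in_set_takeD)
    moreover have "e \<in> edges D'" by (simp add: D'_def)
    ultimately show thesis using result[of D'] cut by blast
  qed
  obtain b where b: "b < length es" "a = es ! b" using a(1) by (auto simp: in_set_conv_nth)
  show thesis
  proof (cases "b < j")
    case True
    have "take j es ! b \<in> set (take j es)" using True b by (intro nth_mem) auto
    then show ?thesis using True b j j0 v0 cs
      by (intro *[of vs es j]) (auto simp: joins_def)
  next
    case False
    \<comment> \<open>Read from \<open>tgt G e\<close>, the other arc comes first; it has
      \<open>length es - j\<close> edges and ends at \<open>src G e\<close>.\<close>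
    have r: "rotate j es = drop j es @ take j es" "rotate j vs = drop j vs @ take j vs"
      using j n by (auto simp: rotate_drop_take)
    have "drop j es ! (b - j) \<in> set (drop j es)" using False b by (intro nth_mem) auto
    then have "a \<in> set (take (length es - j) (rotate j es))" using False b by (simp add: r)
    moreover have "rotate j vs ! 0 = tgt G e" "rotate j vs ! (length es - j) = src G e"
      using j j0 n v0 by (auto simp: r nth_append)
    ultimately show ?thesis using j j0 cycle_seq_rotate[OF cs(1), of j]
      by (intro *[of "rotate j vs" "rotate j es" "length es - j"]) (auto simp: joins_def)
  qed
qed

section \<open>Density of the shortcut vertices\<close>

text \<open>The edge-shortcuts of \<open>C\<close> of length at most \<open>m\<close>, with their
  ends read off from \<open>src\<close> and \<open>tgt\<close>; these ends will form the dense
  set.\<close>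

definition chords :: "('v, 'e) mgraph \<Rightarrow> ('v, 'e) mgraph \<Rightarrow> real \<Rightarrow> 'e set" where
  "chords G C m = {e \<in> edges G. src G e \<in> verts C \<and> tgt G e \<in> verts C \<and>
     len G e < gdist C (Vertex (src G e)) (Vertex (tgt G e)) \<and> len G e \<le> m}"

lemma cycle_props:
  assumes "metric_graph G" "cycle G C"
  shows "metric_graph C" "connected_graph C" "finite (verts C)" "finite (edges C)"
    "edges C \<subseteq> edges G" "verts C \<subseteq> verts G"
    "src C = src G" "tgt C = tgt G" "len C = len G" "edge_point C = edge_point G"
proof -
  obtain vs es where cs: "cycle_seq G vs es" "C = subgraph_of G (set vs) (set es)"
    using assms(2) cycle_iff_cycle_seq by metis
  show "metric_graph C" "connected_graph C"
    using metric_graph_cycle_seq[OF assms(1) cs(1)] connected_cycle_seq[OF assms(1) cs(1)] cs(2) by auto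
  show "finite (verts C)" "finite (edges C)" "edges C \<subseteq> edges G" "verts C \<subseteq> verts G"
    "src C = src G" "tgt C = tgt G" "len C = len G" "edge_point C = edge_point G"
    using cs by (auto simp: cycle_seq_def)
qed

text \<open>The path \<open>[(e, 0, len G e)]\<close> starts at the source and ends at the target of
  \<open>e\<close>, which determines \<open>p\<close> and \<open>q\<close>.\<close>

lemma edge_shortcut_ends:
  assumes "metric_graph G" "edge_shortcut G C e"
  shows "e \<in> edges G" "src G e \<in> verts C" "tgt G e \<in> verts C"
    "len G e < gdist C (Vertex (src G e)) (Vertex (tgt G e))"
proof -
  obtain p q where e: "e \<in> edges G" "shortcut G C [(e, 0, len G e)] p q"
    using assms(2) by (auto simp: edge_shortcut_def)
  then have "p = src G e" "q = tgt G e"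
    using edge_point_len[OF assms(1) e(1)] by (auto simp: shortcut_def)
  then show "e \<in> edges G" "src G e \<in> verts C" "tgt G e \<in> verts C"
    "len G e < gdist C (Vertex (src G e)) (Vertex (tgt G e))"
    using e metric_graphD(3)[OF assms(1) e(1)] by (auto simp: shortcut_def)
qed

lemma chord_notin_cycle:
  "metric_graph G \<Longrightarrow> cycle G C \<Longrightarrow> e \<in> chords G C m \<Longrightarrow> e \<notin> edges C"
  using gdist_edge[of C e] cycle_props[of G C] by (auto simp: chords_def)

text \<open>An inner point of \<open>e\<close> lies in \<open>C\<close> only if \<open>e\<close> is
  an edge of \<open>C\<close>, and \<open>chord_notin_cycle\<close> excludes this.\<close>

lemma chord_meets_cycle:
  assumes "metric_graph G" "cycle G C" "e \<in> chords G C m" "edge_point G e t \<in> points C"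
  shows "edge_point G e t \<in> {Vertex (src G e), Vertex (tgt G e)}"
  using assms(4) chord_notin_cycle[OF assms(1-3)] cycle_props[OF assms(1,2)]
  by (auto simp: points_def edge_point_def split: if_splits)

lemma chord_strict_shortcut:
  assumes G: "metric_graph G" and C: "cycle G C" and e: "e \<in> chords G C m"
  shows "strict_shortcut G C [(e, 0, len G e)] (src G e) (tgt G e)"
proof -
  have eG: "e \<in> edges G" using e by (simp add: chords_def)
  note l = metric_graphD[OF G eG] and ep = edge_point_len[OF G eG]
  have "path_image G [(e, 0, len G e)] \<inter> points C = {Vertex (src G e), Vertex (tgt G e)}"
  proof
    show "path_image G [(e, 0, len G e)] \<inter> points C \<subseteq> {Vertex (src G e), Vertex (tgt G e)}"
      using chord_meets_cycle[OF G C e] by (auto simp: path_image_def)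
    have "edge_point G e 0 \<in> path_image G [(e, 0, len G e)]"
      "edge_point G e (len G e) \<in> path_image G [(e, 0, len G e)]"
      using l by (auto simp: path_image_def intro!: imageI simp del: edge_point_0)
    then show "{Vertex (src G e), Vertex (tgt G e)} \<subseteq> path_image G [(e, 0, len G e)] \<inter> points C"
      using e ep by (auto simp: chords_def Vertex_in_points)
  qed
  then show ?thesis
    using e l ep eG by (auto simp: strict_shortcut_def shortcut_def chords_def Vertex_in_points)
qed

section \<open>A short cycle through a given point\<close>

lemma finite_incident_edges:
  assumes "locally_finite G" "finite V" "V \<subseteq> verts G"
  shows "finite {e \<in> edges G. src G e \<in> V}"
proof -
  have "finite (\<Union>v\<in>V. {e \<in> edges G. src G e = v \<or> tgt G e = v})"
    using assms by (intro finite_UN_I) (auto simp: locally_finite_def)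
  then show ?thesis by (rule rev_finite_subset) auto
qed

text \<open>Repeated cutting is expressed by minimality: \<open>D\<close> is a shortest member of a
  finite family \<open>F\<close> closed under the cuts. If its length were at least
  \<open>k\<close>, one more cut would give a shorter member.\<close>

lemma short_cycle_through_point:
  assumes G: "metric_graph G" "locally_finite G" "edge_chordal G k m"
    and C: "cycle G C" "k \<le> total_length C" and x: "x \<in> points C"
  obtains D where "cycle G D" "total_length D < k" "x \<in> points D"
    "edges D \<subseteq> edges C \<union> chords G C m" "edges D \<inter> chords G C m \<noteq> {}"
proof -
  \<comment> \<open>The distance condition turns edge-shortcuts of a member of \<open>F\<close> into
    edge-shortcuts of \<open>C\<close>. The disjunct \<open>D = C\<close> admits the starting cycle,
    which has no chord among its edges.\<close>
  define F where "F = {D. cycle G D \<and> x \<in> points D \<and> verts D \<subseteq> verts C \<and>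
    edges D \<subseteq> edges C \<union> chords G C m \<and> (D = C \<or> edges D \<inter> chords G C m \<noteq> {}) \<and>
    (\<forall>u\<in>verts D. \<forall>v\<in>verts D. gdist D (Vertex u) (Vertex v) \<le> gdist C (Vertex u) (Vertex v))}"
  note Cp = cycle_props[OF G(1) C(1)]
  let ?E = "{e \<in> edges G. src G e \<in> verts C}"
  \<comment> \<open>A cycle in \<open>G\<close> is determined by its vertex set and edge set, and by
    local finiteness only finitely many edges start at vertices of \<open>C\<close>.\<close>
  have "F \<subseteq> (\<lambda>(V, E). subgraph_of G V E) ` (Pow (verts C) \<times> Pow ?E)"
  proof
    fix D assume D: "D \<in> F"
    then have cD: "cycle G D" and V: "verts D \<subseteq> verts C" by (auto simp: F_def)
    note Dp = cycle_props[OF G(1) cD]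
    have "edges D \<subseteq> ?E" using V Dp metric_graphD[OF Dp(1)] by auto
    moreover have "D = subgraph_of G (verts D) (edges D)" using cD by (auto simp: cycle_def)
    ultimately show "D \<in> (\<lambda>(V, E). subgraph_of G V E) ` (Pow (verts C) \<times> Pow ?E)"
      using V by (intro image_eqI[of _ _ "(verts D, edges D)"]) auto
  qed
  moreover have "finite ?E" using finite_incident_edges[OF G(2)] Cp by blast
  ultimately have "finite F" using Cp(3) by (auto intro: finite_subset)
  moreover have CF: "C \<in> F" using C x by (auto simp: F_def)
  ultimately obtain D where "is_arg_min total_length (\<lambda>D. D \<in> F) D"
    using ex_is_arg_min_if_finite[of F total_length] by auto
  then have D: "D \<in> F"
    and min: "\<And>D'. D' \<in> F \<Longrightarrow> total_length D \<le> total_length D'"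
    by (auto simp: is_arg_min_linorder)
  from D have cD: "cycle G D" "x \<in> points D" "verts D \<subseteq> verts C"
    "edges D \<subseteq> edges C \<union> chords G C m" "D = C \<or> edges D \<inter> chords G C m \<noteq> {}"
    and dist: "\<And>u v. u \<in> verts D \<Longrightarrow> v \<in> verts D \<Longrightarrow>
      gdist D (Vertex u) (Vertex v) \<le> gdist C (Vertex u) (Vertex v)"
    by (auto simp: F_def)
  have small: "total_length D < k"
  proof (rule ccontr)
    assume "\<not> total_length D < k"
    then obtain e where es: "edge_shortcut G D e" "len G e \<le> m"
      using G(3) cD(1) by (auto simp: edge_chordal_def not_less)
    note e = edge_shortcut_ends[OF G(1) es(1)]
    have ch: "e \<in> chords G C m"
      using e es(2) cD(3) dist[OF e(2,3)] by (auto simp: chords_def)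
    obtain D' where D': "cycle G D'" "total_length D' < total_length D" "x \<in> points D'"
      "verts D' \<subseteq> verts D" "e \<in> edges D'" "edges D' \<subseteq> insert e (edges D)"
      "\<And>u v. u \<in> verts D' \<Longrightarrow> v \<in> verts D' \<Longrightarrow>
         gdist D' (Vertex u) (Vertex v) \<le> gdist D (Vertex u) (Vertex v)"
      using cut_cycle[OF G(1) cD(1,2) e] by blast
    have "D' \<in> F"
      unfolding F_def
    proof (intro CollectI conjI ballI)
      fix u v assume "u \<in> verts D'" "v \<in> verts D'"
      then show "gdist D' (Vertex u) (Vertex v) \<le> gdist C (Vertex u) (Vertex v)"
        using D'(4) D'(7)[of u v] dist[of u v] by fastforce
    qed (use D' ch cD in auto)
    then show False using min D'(2) by fastforce
  qed
  \<comment> \<open>This leaves the second disjunct in \<open>F\<close>: some edge of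
    \<open>D\<close> is a chord.\<close>
  then have "D \<noteq> C" using C(2) by auto
  then show thesis using that cD small by blast
qed

text \<open>
  The factor 2 leaves room for walking from \<open>x\<close> to either end of its edge before following the
  cycle \<open>D\<close> from there.
\<close>

lemma chord_vertex_near_point:
  assumes G: "metric_graph G" and C: "cycle G C" and x: "x \<in> points C"
    and D: "cycle G D" "x \<in> points D" "edges D \<subseteq> edges C \<union> chords G C m"
      "edges D \<inter> chords G C m \<noteq> {}"
  obtains e v where "e \<in> chords G C m" "v \<in> {src G e, tgt G e}"
    "gdist C (Vertex v) x \<le> 2 * total_length D"
proof -
  note Cp = cycle_props[OF G C]
  obtain vs0 es0 where cs0: "cycle_seq G vs0 es0" "D = subgraph_of G (set vs0) (set es0)"
    using D(1) cycle_iff_cycle_seq by metis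
  obtain a t where a: "a \<in> set es0" "t \<in> {0..len G a}" "x = edge_point G a t"
    using points_cycle_seq[OF G cs0(1), of x] D(2) cs0(2) by auto
  obtain i where i: "i < length es0" "es0 ! i = a" using a by (auto simp: in_set_conv_nth)
  obtain vs es where cs: "cycle_seq G vs es" "set vs = set vs0" "set es = set es0"
    and e0: "es ! 0 = a"
    using cycle_seq_rotate_to[OF cs0(1) i(1)] i(2) by metis
  let ?n = "length es"
  have n: "0 < ?n" "length vs = ?n" using cs by (auto simp: cycle_seq_def)
  have Deq: "D = subgraph_of G (set vs) (set es)" using cs cs0 by simp
  have eG: "es ! l \<in> edges G" if "l < ?n" for l using cs that by (auto simp: cycle_seq_def)
  have tl: "total_length D = (\<Sum>l<?n. len G (es ! l))"
    using total_length_cycle_seq[OF cs(1)] Deq by simp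
  have pos: "0 \<le> len G (es ! l)" if "l < ?n" for l
    using metric_graphD(3)[OF G eG[OF that]] by simp
  have tl_ge: "(\<Sum>l<r. len G (es ! l)) \<le> total_length D" if "r \<le> ?n" for r
    unfolding tl using that pos by (intro sum_mono2) auto
  obtain c where c: "c < ?n" "es ! c \<in> chords G C m"
    using D(4) Deq by (auto simp: in_set_conv_nth)
  \<comment> \<open>The index of the first chord met along \<open>D\<close> from the edge
    \<open>a\<close> on; all earlier edges belong to \<open>C\<close>, so the walk up to
    \<open>vs ! r\<close> stays in \<open>C\<close>.\<close>
  define r where "r = (LEAST r. es ! r \<in> chords G C m)"
  have r: "es ! r \<in> chords G C m" "r \<le> c" unfolding r_def using c by (auto intro: LeastI Least_le)
  have inC: "es ! l \<in> edges C" if "l < r" for l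
  proof -
    have "l < ?n" using that r c by auto
    then have "es ! l \<in> edges C \<union> chords G C m" using D(3) Deq by (auto dest: nth_mem)
    then show ?thesis using not_less_Least[of l] that by (auto simp: r_def)
  qed
  show thesis
  proof (cases "r = 0")
    case True
    \<comment> \<open>Here \<open>x\<close> lies on the chord \<open>a\<close> and on
      \<open>C\<close>, so it is itself an end of \<open>a\<close>.\<close>
    then have ch: "a \<in> chords G C m" using r e0 by simp
    then obtain v where v: "v \<in> {src G a, tgt G a}" "x = Vertex v"
      using chord_meets_cycle[OF G C ch, of t] x a by auto
    have "gdist C (Vertex v) x \<le> 2 * total_length D"
      using gdist_refl[of x C] x v tl_ge[of 0] by simp
    then show thesis using that ch v by blast
  next
    case False
    have jo: "joins G (es ! l) (vs ! l) (vs ! (Suc l mod ?n))" if "l < ?n" for l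
      using cs that by (auto simp: cycle_seq_def)
    have aC: "a \<in> edges C" using inC[of 0] False e0 by simp
    have v0: "vs ! 0 = src G a \<or> vs ! 0 = tgt G a" using jo[of 0] n e0 by (auto simp: joins_def)
    have v0C: "Vertex (vs ! 0) \<in> points C"
      using v0 metric_graphD[OF Cp(1) aC] Cp by (auto intro: Vertex_in_points)
    have l0: "len G a \<le> total_length D" using tl_ge[of 1] n e0 by simp
    have 1: "gdist C (Vertex (vs ! 0)) x \<le> len G a"
    proof -
      \<comment> \<open>The sequence may start at either end of \<open>a\<close>; \<open>s\<close>
        is the parameter of that end.\<close>
      obtain s where s: "s \<in> {0, len G a}" "edge_point G a s = Vertex (vs ! 0)"
        using v0
      proof
        assume "vs ! 0 = src G a"
        then show thesis by (intro that[of 0]) auto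
      next
        assume "vs ! 0 = tgt G a"
        then show thesis
          using edge_point_len[OF G, of a] aC Cp(5) by (intro that[of "len G a"]) auto
      qed
      have "gdist C (edge_point C a s) (edge_point C a t) \<le> \<bar>t - s\<bar>"
        using gdist_same_edge[OF aC, of s t] s(1) a(2) Cp by auto
      then show ?thesis using s a Cp by auto
    qed
    have "\<exists>\<sigma>. path_between C (Vertex (vs ! 0)) \<sigma> (Vertex (vs ! r)) \<and>
        path_length \<sigma> = (\<Sum>l=0..<r. len C (es ! l))"
    proof (rule walk_path[OF Cp(1)])
      fix l assume "l < r"
      then have "l < ?n" "Suc l mod ?n = Suc l" using r c by auto
      then show "es ! l \<in> edges C \<and> joins C (es ! l) (vs ! l) (vs ! Suc l)"
        using jo[of l] inC[OF \<open>l < r\<close>] Cp by (simp add: joins_def)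
    qed (use v0C in auto)
    then have 2: "gdist C (Vertex (vs ! 0)) (Vertex (vs ! r)) \<le> total_length D"
      using gdist_le tl_ge[of r] r c Cp by (fastforce simp: atLeast0LessThan)
    have vr: "vs ! r \<in> {src G (es ! r), tgt G (es ! r)}"
      using jo[of r] r c by (auto simp: joins_def)
    then have "Vertex (vs ! r) \<in> points C"
      using r by (auto simp: chords_def intro!: Vertex_in_points)
    then have "gdist C (Vertex (vs ! r)) x \<le> 2 * total_length D"
      using gdist_triangle[OF Cp(2) _ v0C x] gdist_commute[OF Cp(2) v0C] 1 2 l0 by fastforce
    then show thesis using that r vr by blast
  qed
qed

theorem theorem2p3:
  fixes G :: "('v, 'e) mgraph" and k m :: real
  assumes "metric_graph G" and "connected_graph G" and "locally_finite G"
    and "k \<ge> 0" and "m \<ge> 0"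
    and "edge_chordal G k m"
  shows "\<exists>\<epsilon> > 0. densely_path_chordal \<epsilon> G k m"
proof (intro exI conjI)
  \<comment> \<open>The distances found below are at most \<open>2 * total_length D\<close>, hence
    less than \<open>2 * k\<close>; adding 1 keeps the constant positive for
    \<open>k = 0\<close>.\<close>
  show "0 < 2 * k + 1" using assms(4) by simp
  show "densely_path_chordal (2 * k + 1) G k m"
    unfolding densely_path_chordal_def
  proof (intro allI impI)
    fix C assume "cycle G C \<and> k \<le> total_length C"
    then have C: "cycle G C" "k \<le> total_length C" by auto
    note Cp = cycle_props[OF assms(1) C(1)]
    \<comment> \<open>All chords are taken, each run through once from source to target, so that
      \<open>S\<close> serves every point \<open>x\<close> whichever chord is found near it.\<close>
    define S where "S = (\<lambda>e. ([(e, 0 :: real, len G e)], src G e, tgt G e)) ` chords G C m"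
    have "finite (chords G C m)"
      using finite_incident_edges[OF assms(3) Cp(3,6)]
      by (rule rev_finite_subset) (auto simp: chords_def)
    then have "finite S" by (simp add: S_def)
    moreover have "\<forall>(\<sigma>, p, q) \<in> S. strict_shortcut G C \<sigma> p q \<and> path_length \<sigma> \<le> m"
      using chord_strict_shortcut[OF assms(1) C(1)] metric_graphD(3)[OF assms(1)]
      by (fastforce simp: S_def chords_def)
    moreover have "eps_dense (2 * k + 1) (\<Union>(\<sigma>, p, q) \<in> S. {Vertex p, Vertex q}) (points C) (gdist C)"
      unfolding eps_dense_def
    proof (intro conjI ballI)
      show "(\<Union>(\<sigma>, p, q) \<in> S. {Vertex p, Vertex q}) \<subseteq> points C"
        by (auto simp: S_def chords_def intro: Vertex_in_points)
      fix x assume x: "x \<in> points C"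
      obtain D where D: "cycle G D" "total_length D < k" "x \<in> points D"
        "edges D \<subseteq> edges C \<union> chords G C m" "edges D \<inter> chords G C m \<noteq> {}"
        using short_cycle_through_point[OF assms(1,3,6) C x] by blast
      obtain e v where e: "e \<in> chords G C m" "v \<in> {src G e, tgt G e}"
        "gdist C (Vertex v) x \<le> 2 * total_length D"
        using chord_vertex_near_point[OF assms(1) C(1) x D(1,3,4,5)] by blast
      have "Vertex v \<in> (\<Union>(\<sigma>, p, q) \<in> S. {Vertex p, Vertex q})"
        using e by (auto simp: S_def)
      moreover have "gdist C (Vertex v) x < 2 * k + 1" using e D by simp
      ultimately show "\<exists>a\<in>\<Union>(\<sigma>, p, q) \<in> S. {Vertex p, Vertex q}. gdist C a x < 2 * k + 1"
        by (rule bexI[rotated])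
    qed
    ultimately show "\<exists>S. finite S \<and>
        (\<forall>(\<sigma>, p, q) \<in> S. strict_shortcut G C \<sigma> p q \<and> path_length \<sigma> \<le> m) \<and>
        eps_dense (2 * k + 1) (\<Union>(\<sigma>, p, q) \<in> S. {Vertex p, Vertex q}) (points C) (gdist C)"
      by (intro exI[of _ S] conjI)
  qed
qed

end
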